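(* Let $(X,d)$ be a cone metric space associated with a real Banach space $E$ and a cone $P\subseteq E$. Let $r\in E$ with $0\ll r$ or $r=0$. Then every sequence $\{x_n\}$ in $X$ that is $\frac{r}{2}$-convergent (to some point of $X$) is $r$-Cauchy.
   Context: Cone: a subset $P$ of a real Banach space $E$ is a cone if (i) $P$ is closed, nonempty and $P\neq\{0\}$; (ii) $ax+by\in P$ for all real $a,b\ge 0$ and all $x,y\in P$; (iii) $x\in P$ and $-x\in P$ imply $x=0$. Orderings: for $x,y\in E$, $x\le y$ means $y-x\in P$, and $x\ll y$ means $y-x\in \operatorname{int}P$ (the interior of $P$). Cone metric space: a nonempty set $X$ with a map $d:X\times X\to E$ such that for all $x,y,z\in X$: $0\le d(x,y)$, with $d(x,y)=0$ if and only if $x=y$; $d(x,y)=d(y,x)$; $d(x,y)\le d(x,z)+d(z,y)$. Let $\rho\in E$ with $0\ll\rho$ or $\rho=0$. A sequence $\{x_n\}$ in $X$ is $\rho$-convergent to $x\in X$ if for every $\epsilon\in E$ with $0\ll\epsilon$ there is $k\in\mathbb{N}$ such that $d(x_n,x)\ll\rho+\epsilon$ for all $n\ge k$. It is $\rho$-convergent if it is $\rho$-convergent to some $x\in X$. A sequence $\{x_n\}$ in $X$ is $\rho$-Cauchy if for every $\epsilon\in E$ with $0\ll\epsilon$ there is $m\in\mathbb{N}$ such that $d(x_i,x_j)\ll\rho+\epsilon$ for all $i,j\ge m$. *)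

theory Defs
  imports "HOL-Analysis.Analysis"
begin

text \<open>The predicate \<open>cone\<close> of the library only asks for closure under nonnegative scaling, hence the
  separate name.\<close>

definition is_order_cone :: "'e::banach set \<Rightarrow> bool" where
  "is_order_cone P \<longleftrightarrow>
     closed P \<and> P \<noteq> {} \<and> P \<noteq> {0} \<and>
     (\<forall>a b :: real. \<forall>x\<in>P. \<forall>y\<in>P. 0 \<le> a \<longrightarrow> 0 \<le> b \<longrightarrow> a *\<^sub>R x + b *\<^sub>R y \<in> P) \<and>
     (\<forall>x. x \<in> P \<longrightarrow> - x \<in> P \<longrightarrow> x = 0)"

definition cone_le :: "'e::banach set \<Rightarrow> 'e \<Rightarrow> 'e \<Rightarrow> bool" where
  "cone_le P x y \<longleftrightarrow> y - x \<in> P"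

definition cone_ll :: "'e::banach set \<Rightarrow> 'e \<Rightarrow> 'e \<Rightarrow> bool" where
  "cone_ll P x y \<longleftrightarrow> y - x \<in> interior P"

text \<open>The underlying set is a carrier \<open>X\<close> inside a type; \<open>d\<close> is unconstrained outside \<open>X\<close>.\<close>

definition cone_metric_space :: "'e::banach set \<Rightarrow> 'a set \<Rightarrow> ('a \<Rightarrow> 'a \<Rightarrow> 'e) \<Rightarrow> bool" where
  "cone_metric_space P X d \<longleftrightarrow>
     is_order_cone P \<and> X \<noteq> {} \<and>
     (\<forall>x\<in>X. \<forall>y\<in>X. cone_le P 0 (d x y) \<and> (d x y = 0 \<longleftrightarrow> x = y)) \<and>
     (\<forall>x\<in>X. \<forall>y\<in>X. d x y = d y x) \<and>
     (\<forall>x\<in>X. \<forall>y\<in>X. \<forall>z\<in>X. cone_le P (d x y) (d x z + d z y))"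

text \<open>The notions below are meant for \<open>\<rho>\<close> with \<open>\<rho> = 0\<close> or \<open>cone_ll P 0 \<rho>\<close>, and for sequences in \<open>X\<close>;
  these restrictions are hypotheses wherever the notions are used, not part of the definitions.\<close>

definition rho_convergent_to ::
  "'e::banach set \<Rightarrow> ('a \<Rightarrow> 'a \<Rightarrow> 'e) \<Rightarrow> 'e \<Rightarrow> (nat \<Rightarrow> 'a) \<Rightarrow> 'a \<Rightarrow> bool" where
  "rho_convergent_to P d \<rho> s x \<longleftrightarrow>
     (\<forall>\<epsilon>. cone_ll P 0 \<epsilon> \<longrightarrow> (\<exists>k. \<forall>n\<ge>k. cone_ll P (d (s n) x) (\<rho> + \<epsilon>)))"

definition rho_convergent ::
  "'e::banach set \<Rightarrow> 'a set \<Rightarrow> ('a \<Rightarrow> 'a \<Rightarrow> 'e) \<Rightarrow> 'e \<Rightarrow> (nat \<Rightarrow> 'a) \<Rightarrow> bool" where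
  "rho_convergent P X d \<rho> s \<longleftrightarrow> (\<exists>x\<in>X. rho_convergent_to P d \<rho> s x)"

definition rho_Cauchy ::
  "'e::banach set \<Rightarrow> ('a \<Rightarrow> 'a \<Rightarrow> 'e) \<Rightarrow> 'e \<Rightarrow> (nat \<Rightarrow> 'a) \<Rightarrow> bool" where
  "rho_Cauchy P d \<rho> s \<longleftrightarrow>
     (\<forall>\<epsilon>. cone_ll P 0 \<epsilon> \<longrightarrow> (\<exists>m. \<forall>i\<ge>m. \<forall>j\<ge>m. cone_ll P (d (s i) (s j)) (\<rho> + \<epsilon>)))"

end

theory Submission
  imports Defs
begin

text \<open>Halving the tolerance reduces the claim to the triangle inequality through the limit x:
  for large i and j, both d(s i, x) and d(s j, x) are \<open>cone_ll\<close>-below r/2 +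
  \<epsilon>/2, and these two bounds sum to r + \<epsilon>. In the cone order this needs three facts
  about the interior of \<open>P\<close>: it is stable under positive scaling
  (\<open>interior_order_cone_scaleR\<close>), so \<epsilon>/2 is an admissible tolerance; strict
  inequalities add (\<open>cone_ll_add\<close>); and \<open>cone_le\<close> followed by
  \<open>cone_ll\<close> gives \<open>cone_ll\<close> (\<open>cone_le_ll_trans\<close>). The last
  two rest on \<open>interior_order_cone_add\<close>.\<close>

lemma order_cone_add:
  assumes "is_order_cone P" "x \<in> P" "y \<in> P"
  shows "x + y \<in> P"
proof -
  have "1 *\<^sub>R x + 1 *\<^sub>R y \<in> P"
    using assms unfolding is_order_cone_def by (meson zero_le_one)
  then show ?thesis by simp
qed

lemma order_cone_scaleR:
  assumes "is_order_cone P" "x \<in> P" "0 \<le> c"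
  shows "c *\<^sub>R x \<in> P"
proof -
  have "c *\<^sub>R x + 0 *\<^sub>R x \<in> P"
    using assms unfolding is_order_cone_def by (meson order_refl)
  then show ?thesis by simp
qed

text \<open>The translate of \<open>interior P\<close> by \<open>y\<close> is open, and it lies in
  \<open>P\<close> because \<open>P\<close> is closed under addition; hence all its points are
  interior to \<open>P\<close>.\<close>

lemma interior_order_cone_add:
  assumes P: "is_order_cone P" and x: "x \<in> interior P" and y: "y \<in> P"
  shows "x + y \<in> interior P"
proof (rule interiorI)
  show "open ((+) y ` interior P)" by (intro open_translation open_interior)
  show "x + y \<in> (+) y ` interior P" using x by (auto simp: add.commute)
  show "(+) y ` interior P \<subseteq> P"
    using order_cone_add[OF P y] interior_subset by blast
qed

text \<open>Scaling by \<open>c\<close> is an open map since \<open>c\<close> is nonzero, and it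
  sends \<open>P\<close> into itself, so the image of the interior is an open subset of
  \<open>P\<close>.\<close>

lemma interior_order_cone_scaleR:
  assumes P: "is_order_cone P" and x: "x \<in> interior P" and c: "0 < c"
  shows "c *\<^sub>R x \<in> interior P"
proof (rule interiorI)
  show "open ((*\<^sub>R) c ` interior P)" using c by (intro open_scaling open_interior) auto
  show "c *\<^sub>R x \<in> (*\<^sub>R) c ` interior P" using x by (rule imageI)
  show "(*\<^sub>R) c ` interior P \<subseteq> P"
    using order_cone_scaleR[OF P] c interior_subset[of P] by (auto simp: subset_eq)
qed

lemma cone_ll_add:
  assumes "is_order_cone P" "cone_ll P x y" "cone_ll P u v"
  shows "cone_ll P (x + u) (y + v)"
proof -
  have "(y - x) + (v - u) \<in> interior P"
    using assms interior_subset unfolding cone_ll_def by (blast intro: interior_order_cone_add)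
  then show ?thesis by (simp add: cone_ll_def algebra_simps)
qed

text \<open>Split \<open>z - x\<close> as \<open>(z - y) + (y - x)\<close>, an interior point plus a
  point of the cone.\<close>

lemma cone_le_ll_trans:
  assumes "is_order_cone P" "cone_le P x y" "cone_ll P y z"
  shows "cone_ll P x z"
  using interior_order_cone_add[of P "z - y" "y - x"] assms
  by (simp add: cone_ll_def cone_le_def)

theorem theorem3p1:
  fixes P :: "'e::banach set" and X :: "'a set" and d :: "'a \<Rightarrow> 'a \<Rightarrow> 'e"
    and r :: 'e and s :: "nat \<Rightarrow> 'a"
  assumes "cone_metric_space P X d"
    and "cone_ll P 0 r \<or> r = 0"
    and "\<forall>n. s n \<in> X"
    and "rho_convergent P X d (r /\<^sub>R 2) s"
  shows "rho_Cauchy P d r s"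
  unfolding rho_Cauchy_def
proof (intro allI impI)
  fix \<epsilon> assume \<epsilon>: "cone_ll P 0 \<epsilon>"
  have P: "is_order_cone P" using assms(1) by (simp add: cone_metric_space_def)
  obtain x where x: "x \<in> X" and conv: "rho_convergent_to P d (r /\<^sub>R 2) s x"
    using assms(4) by (auto simp: rho_convergent_def)
  have "cone_ll P 0 (\<epsilon> /\<^sub>R 2)"
    using interior_order_cone_scaleR[OF P, of \<epsilon> "inverse 2"] \<epsilon> by (simp add: cone_ll_def)
  then obtain k where k: "\<And>n. n \<ge> k \<Longrightarrow> cone_ll P (d (s n) x) (r /\<^sub>R 2 + \<epsilon> /\<^sub>R 2)"
    using conv unfolding rho_convergent_to_def by blast
  \<comment> \<open>The left side is the bound that \<open>cone_ll_add\<close> produces from two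
    instances of \<open>k\<close>.\<close>
  have halves: "(r /\<^sub>R 2 + \<epsilon> /\<^sub>R 2) + (r /\<^sub>R 2 + \<epsilon> /\<^sub>R 2) = r + \<epsilon>"
    by (simp flip: scaleR_add_right scaleR_add_left scaleR_2)
  have "cone_ll P (d (s i) (s j)) (r + \<epsilon>)" if "i \<ge> k" "j \<ge> k" for i j
  proof -
    \<comment> \<open>Symmetry of \<open>d\<close> puts \<open>x\<close> second in both terms, the
      form in which \<open>k\<close> bounds them.\<close>
    have "cone_le P (d (s i) (s j)) (d (s i) x + d (s j) x)"
      using assms(1,3) x unfolding cone_metric_space_def by metis
    then show ?thesis
      using cone_le_ll_trans[OF P _ cone_ll_add[OF P k k]] that halves by metis
  qed
  then show "\<exists>m. \<forall>i\<ge>m. \<forall>j\<ge>m. cone_ll P (d (s i) (s j)) (r + \<epsilon>)" by blast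
qed

end
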